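(* Let $p$ be a prime number and let $A$ be a zero-sum free subset of $\mathbb{Z}/p\mathbb{Z}$ of maximal cardinality (among all zero-sum free subsets of $\mathbb{Z}/p\mathbb{Z}$). Then $|A|$ is the greatest integer $k$ such that $\frac{k(k+1)}{2}<p$.
   Context: For $A\subset\mathbb{Z}/p\mathbb{Z}$, $\Sigma^*(A)=\{\sum_{x\in I}x : \emptyset\neq I\subset A\}$. A subset $A$ is zero-sum free if $0\notin\Sigma^*(A)$. *)

theory Defs
  imports "HOL-Number_Theory.Residues"
begin

definition nonempty_subset_sums :: "('a, 'm) ring_scheme \<Rightarrow> 'a set \<Rightarrow> 'a set" where
  "nonempty_subset_sums R A = {finsum R (\<lambda>x. x) I | I. I \<noteq> {} \<and> I \<subseteq> A}"

definition zero_sum_free :: "('a, 'm) ring_scheme \<Rightarrow> 'a set \<Rightarrow> bool" where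
  "zero_sum_free R A \<longleftrightarrow> A \<subseteq> carrier R \<and> \<zero>\<^bsub>R\<^esub> \<notin> nonempty_subset_sums R A"

end

theory Submission
  imports Defs "Jordan_Normal_Form.Determinant"
begin

text \<open>
  Let \<open>A = {a\<^sub>1, \<dots>, a\<^sub>n}\<close> and let \<open>V\<close> be the Vandermonde determinant. For a sign vector
  \<open>\<epsilon>\<close> write \<open>y = (\<epsilon>\<^sub>1 a\<^sub>1, \<dots>, \<epsilon>\<^sub>n a\<^sub>n)\<close>. The alternating sum over all \<open>\<epsilon>\<close> of
  \<open>V(y) (y\<^sub>1 + \<dots> + y\<^sub>n)\<^sup>k\<close> is a combination of determinants of powers of the \<open>a\<^sub>i\<close> in which
  only distinct odd exponents survive; as these add up to at least \<open>n\<^sup>2\<close>, the sum vanishes for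
  \<open>k < n (n + 1) / 2\<close>. The same then holds with \<open>y\<^sub>1 + \<dots> + y\<^sub>n + a\<^sub>1 + \<dots> + a\<^sub>n\<close>, which is
  twice a subset sum, in place of \<open>y\<^sub>1 + \<dots> + y\<^sub>n\<close>. If \<open>A\<close> is zero-sum free and
  \<open>p \<le> n (n + 1) / 2\<close>, take \<open>k = p - 1\<close> and subtract the case \<open>k = 0\<close>: by Fermat's theorem all
  terms but the one of the empty set vanish modulo \<open>p\<close>, so \<open>p\<close> divides \<open>V(-a)\<close>, which is
  impossible. Conversely, \<open>{1, \<dots>, k}\<close> is zero-sum free whenever \<open>k (k + 1) / 2 < p\<close>.
\<close>

section \<open>Alternants and multiplication by the sum of the variables\<close>

definition alternant :: "nat \<Rightarrow> (nat \<Rightarrow> 'a::comm_ring_1) \<Rightarrow> (nat \<Rightarrow> nat) \<Rightarrow> 'a" where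
  "alternant n y e = det (mat n n (\<lambda>(i, j). y j ^ e i))"

text \<open>The set \<open>I\<close> encodes the sign vector by its plus signs. On the constant
  function 1 this is the sign vector itself, and the product of its entries is the weight in the
  alternating sums below.\<close>

definition sign_flip :: "nat set \<Rightarrow> (nat \<Rightarrow> 'a::comm_ring_1) \<Rightarrow> nat \<Rightarrow> 'a" where
  "sign_flip I a i = (if i \<in> I then a i else - a i)"

lemma alternant_Leibniz:
  "alternant n y e = (\<Sum>\<sigma> | \<sigma> permutes {0..<n}. signof \<sigma> * (\<Prod>i=0..<n. y (\<sigma> i) ^ e i))"
proof -
  have *: "mat n n (\<lambda>(i, j). y j ^ e i) $$ (i, \<sigma> i) = y (\<sigma> i) ^ e i"
    if "\<sigma> permutes {0..<n}" "i < n" for \<sigma> i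
    using that permutes_in_image[OF that(1), of i] by simp
  show ?thesis
    unfolding alternant_def
    by (subst det_def'[of _ n]) (auto intro!: sum.cong prod.cong simp: *)
qed

lemma alternant_eq_0_if_not_inj:
  assumes "\<not> inj_on e {0..<n}"
  shows "alternant n y e = 0"
proof -
  obtain i j where ij: "i \<noteq> j" "i < n" "j < n" "e i = e j"
    using assms by (auto simp: inj_on_def)
  show ?thesis
    unfolding alternant_def
    by (rule det_identical_rows[of _ n i j]) (use ij in auto)
qed

text \<open>The sum of the variables is symmetric, so each Leibniz term may reindex it by its own
  permutation; the summand \<open>y (\<sigma> j)\<close> then raises just the exponent of row
  \<open>j\<close>.\<close>

lemma sum_mult_alternant:
  "(\<Sum>i=0..<n. y i) * alternant n y e = (\<Sum>j=0..<n. alternant n y (e(j := Suc (e j))))"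
proof -
  have *: "(\<Sum>i=0..<n. y i) * (\<Prod>i=0..<n. y (\<sigma> i) ^ e i)
      = (\<Sum>j=0..<n. \<Prod>i=0..<n. y (\<sigma> i) ^ (e(j := Suc (e j))) i)"
    if "\<sigma> permutes {0..<n}" for \<sigma>
  proof -
    have "(\<Sum>i=0..<n. y i) = (\<Sum>j=0..<n. y (\<sigma> j))"
      using sum.permute[OF that, of y] by (simp add: o_def)
    moreover have "y (\<sigma> j) * (\<Prod>i=0..<n. y (\<sigma> i) ^ e i)
        = (\<Prod>i=0..<n. y (\<sigma> i) ^ (e(j := Suc (e j))) i)" if "j \<in> {0..<n}" for j
    proof -
      have "(\<Prod>i\<in>{0..<n}-{j}. y (\<sigma> i) ^ (e(j := Suc (e j))) i)
          = (\<Prod>i\<in>{0..<n}-{j}. y (\<sigma> i) ^ e i)"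
        by (rule prod.cong) auto
      then show ?thesis
        using that by (simp add: prod.remove[of "{0..<n}" j] mult.assoc)
    qed
    ultimately show ?thesis
      by (simp add: sum_distrib_right)
  qed
  have "(\<Sum>i=0..<n. y i) * alternant n y e
      = (\<Sum>\<sigma> | \<sigma> permutes {0..<n}.
          signof \<sigma> * ((\<Sum>i=0..<n. y i) * (\<Prod>i=0..<n. y (\<sigma> i) ^ e i)))"
    by (simp add: alternant_Leibniz sum_distrib_left mult.left_commute)
  also have "\<dots> = (\<Sum>\<sigma> | \<sigma> permutes {0..<n}. \<Sum>j=0..<n.
          signof \<sigma> * (\<Prod>i=0..<n. y (\<sigma> i) ^ (e(j := Suc (e j))) i))"
    by (intro sum.cong refl) (simp only: * mem_Collect_eq sum_distrib_left)
  also have "\<dots> = (\<Sum>j=0..<n. alternant n y (e(j := Suc (e j))))"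
    unfolding alternant_Leibniz by (rule sum.swap)
  finally show ?thesis .
qed

section \<open>Vanishing of the alternating sums over all sign vectors\<close>

lemma sum_odd_ge_card_square:
  fixes S :: "nat set"
  assumes "finite S" "\<forall>x\<in>S. odd x"
  shows "card S ^ 2 \<le> \<Sum>S"
  using assms
proof (induction S rule: finite_linorder_max_induct)
  case (insert b S)
  \<comment> \<open>There are \<open>b div 2\<close> odd numbers below the new maximum
    \<open>b\<close>. Hence \<open>b\<close> is at least \<open>2 * card S + 1\<close>, the gap
    between consecutive squares.\<close>
  have "S \<subseteq> (\<lambda>i. 2 * i + 1) ` {..<b div 2}"
  proof
    fix x assume "x \<in> S"
    then have "odd x" "x < b" using insert by auto
    then have "x = 2 * (x div 2) + 1" "x div 2 < b div 2"
      using insert.prems by (auto elim!: oddE)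
    then show "x \<in> (\<lambda>i. 2 * i + 1) ` {..<b div 2}" by blast
  qed
  then have "card S \<le> b div 2"
    by (metis card_image_le card_lessThan card_mono finite_imageI finite_lessThan le_trans)
  then have "2 * card S + 1 \<le> b"
    using insert.prems by (auto elim!: oddE)
  moreover have "card S ^ 2 \<le> \<Sum>S" "b \<notin> S" using insert by auto
  ultimately show ?case
    using insert.hyps by (simp add: power2_eq_square)
qed simp

text \<open>Distinct exponents with so small a sum cannot all be odd. Within a Leibniz term the sum
  over signs factors over the variables, and the one carrying an even exponent contributes
  \<open>x ^ e - (- x) ^ e = 0\<close>.\<close>

lemma signed_sum_alternant_eq_0:
  fixes a :: "nat \<Rightarrow> 'a::comm_ring_1"
  assumes "(\<Sum>i=0..<n. e i) < n ^ 2"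
  shows "(\<Sum>I\<in>Pow {0..<n}. (\<Prod>i=0..<n. sign_flip I (\<lambda>_. 1) i) * alternant n (sign_flip I a) e) = 0"
proof (cases "inj_on e {0..<n}")
  case True
  obtain j where j: "j < n" "even (e j)"
  proof (rule ccontr)
    assume "\<not> thesis"
    then have "\<forall>x\<in>e ` {0..<n}. odd x" using that by auto
    then have "card (e ` {0..<n}) ^ 2 \<le> \<Sum>(e ` {0..<n})"
      by (intro sum_odd_ge_card_square) auto
    then show False
      using assms True by (simp add: card_image sum.reindex)
  qed
  have *: "(\<Sum>I\<in>Pow {0..<n}. (\<Prod>i=0..<n. sign_flip I (\<lambda>_. 1) i) *
             (\<Prod>i=0..<n. sign_flip I a (\<sigma> i) ^ e i)) = 0"
    if \<sigma>: "\<sigma> permutes {0..<n}" for \<sigma>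
  proof -
    let ?\<tau> = "Hilbert_Choice.inv \<sigma>"
    have "(\<Prod>i=0..<n. sign_flip I (\<lambda>_. 1) i) * (\<Prod>i=0..<n. sign_flip I a (\<sigma> i) ^ e i)
        = (\<Prod>i\<in>I. a i ^ e (?\<tau> i)) * (\<Prod>i\<in>{0..<n}-I. - ((- a i) ^ e (?\<tau> i)))"
      if I: "I \<in> Pow {0..<n}" for I
    proof -
      \<comment> \<open>Indexing by variables instead of rows lets the weight and the powers be
        merged factor by factor.\<close>
      have "(\<Prod>i=0..<n. sign_flip I a (\<sigma> i) ^ e i)
          = (\<Prod>i=0..<n. sign_flip I a i ^ e (?\<tau> i))"
        by (subst prod.permute[OF \<sigma>]) (simp add: o_def permutes_inverses[OF \<sigma>])
      then have "(\<Prod>i=0..<n. sign_flip I (\<lambda>_. 1) i) * (\<Prod>i=0..<n. sign_flip I a (\<sigma> i) ^ e i)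
          = (\<Prod>i=0..<n. sign_flip I (\<lambda>_. 1) i * sign_flip I a i ^ e (?\<tau> i))"
        by (simp add: prod.distrib)
      also have "\<dots> = (\<Prod>i\<in>{0..<n}-I. sign_flip I (\<lambda>_. 1) i * sign_flip I a i ^ e (?\<tau> i))
                     * (\<Prod>i\<in>I. sign_flip I (\<lambda>_. 1) i * sign_flip I a i ^ e (?\<tau> i))"
        using I by (intro prod.subset_diff) auto
      also have "\<dots> = (\<Prod>i\<in>{0..<n}-I. - ((- a i) ^ e (?\<tau> i))) * (\<Prod>i\<in>I. a i ^ e (?\<tau> i))"
        by (intro arg_cong2[where f = "(*)"] prod.cong) (auto simp: sign_flip_def)
      finally show ?thesis by (simp add: mult.commute)
    qed
    \<comment> \<open>\<open>prod_add\<close>, read from right to left, collapses the sum over all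
      \<open>I\<close> into a product of two-term sums.\<close>
    then have "(\<Sum>I\<in>Pow {0..<n}. (\<Prod>i=0..<n. sign_flip I (\<lambda>_. 1) i) *
             (\<Prod>i=0..<n. sign_flip I a (\<sigma> i) ^ e i))
        = (\<Prod>i=0..<n. a i ^ e (?\<tau> i) + - ((- a i) ^ e (?\<tau> i)))"
      by (subst prod_add) auto
    also have "\<dots> = 0"
    proof (rule prod_zero)
      have "\<sigma> j \<in> {0..<n}" using permutes_in_image[OF \<sigma>, of j] j by simp
      moreover have "a (\<sigma> j) ^ e (?\<tau> (\<sigma> j)) + - ((- a (\<sigma> j)) ^ e (?\<tau> (\<sigma> j))) = 0"
        using j by (simp add: permutes_inverses[OF \<sigma>])
      ultimately show "\<exists>i\<in>{0..<n}. a i ^ e (?\<tau> i) + - ((- a i) ^ e (?\<tau> i)) = 0" by blast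
    qed simp
    finally show ?thesis .
  qed
  have "(\<Sum>I\<in>Pow {0..<n}. (\<Prod>i=0..<n. sign_flip I (\<lambda>_. 1) i) * alternant n (sign_flip I a) e)
      = (\<Sum>\<sigma> | \<sigma> permutes {0..<n}. signof \<sigma> *
          (\<Sum>I\<in>Pow {0..<n}. (\<Prod>i=0..<n. sign_flip I (\<lambda>_. 1) i) *
             (\<Prod>i=0..<n. sign_flip I a (\<sigma> i) ^ e i)))"
    unfolding alternant_Leibniz sum_distrib_left
    by (subst sum.swap) (simp add: mult.left_commute)
  also have "\<dots> = 0"
  proof (intro sum.neutral ballI)
    fix \<sigma> :: "nat \<Rightarrow> nat"
    assume "\<sigma> \<in> {\<sigma>. \<sigma> permutes {0..<n}}"
    then show "signof \<sigma> * (\<Sum>I\<in>Pow {0..<n}. (\<Prod>i=0..<n. sign_flip I (\<lambda>_. 1) i) *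
             (\<Prod>i=0..<n. sign_flip I a (\<sigma> i) ^ e i)) = 0"
      using *[of \<sigma>] by (simp only: mem_Collect_eq mult_zero_right)
  qed
  finally show ?thesis .
qed (simp add: alternant_eq_0_if_not_inj)

text \<open>Each factor of the power is absorbed into the alternant by
  \<open>sum_mult_alternant\<close>, which raises one exponent by 1. The total degree in the
  hypothesis is therefore preserved by the induction on \<open>k\<close>.\<close>

lemma signed_sum_alternant_power_eq_0:
  fixes a :: "nat \<Rightarrow> 'a::comm_ring_1"
  assumes "(\<Sum>i=0..<n. e i) + k < n ^ 2"
  shows "(\<Sum>I\<in>Pow {0..<n}. (\<Prod>i=0..<n. sign_flip I (\<lambda>_. 1) i) *
            alternant n (sign_flip I a) e * (\<Sum>i=0..<n. sign_flip I a i) ^ k) = 0"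
  using assms
proof (induction k arbitrary: e)
  case 0
  then show ?case using signed_sum_alternant_eq_0[of e n a] by simp
next
  case (Suc k)
  let ?t = "\<lambda>I e. (\<Prod>i=0..<n. sign_flip I (\<lambda>_. 1) i) * alternant n (sign_flip I a) e
                  * (\<Sum>i=0..<n. sign_flip I a i) ^ k"
  have "(\<Sum>I\<in>Pow {0..<n}. (\<Prod>i=0..<n. sign_flip I (\<lambda>_. 1) i) *
            alternant n (sign_flip I a) e * (\<Sum>i=0..<n. sign_flip I a i) ^ Suc k)
      = (\<Sum>I\<in>Pow {0..<n}. (\<Prod>i=0..<n. sign_flip I (\<lambda>_. 1) i) *
            ((\<Sum>i=0..<n. sign_flip I a i) * alternant n (sign_flip I a) e)
            * (\<Sum>i=0..<n. sign_flip I a i) ^ k)"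
    by (simp add: mult_ac)
  also have "\<dots> = (\<Sum>I\<in>Pow {0..<n}. \<Sum>j=0..<n. ?t I (e(j := Suc (e j))))"
    by (simp only: sum_mult_alternant) (simp only: sum_distrib_left sum_distrib_right)
  also have "\<dots> = (\<Sum>j=0..<n. \<Sum>I\<in>Pow {0..<n}. ?t I (e(j := Suc (e j))))"
    by (rule sum.swap)
  also have "\<dots> = 0"
  proof (rule sum.neutral, rule ballI)
    fix j assume j: "j \<in> {0..<n}"
    have "(\<Sum>i\<in>{0..<n}-{j}. (e(j := Suc (e j))) i) = (\<Sum>i\<in>{0..<n}-{j}. e i)"
      by (rule sum.cong) auto
    then have "(\<Sum>i=0..<n. (e(j := Suc (e j))) i) = Suc (\<Sum>i=0..<n. e i)"
      using j by (simp add: sum.remove[of "{0..<n}" j])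
    then show "(\<Sum>I\<in>Pow {0..<n}. ?t I (e(j := Suc (e j)))) = 0"
      using Suc.prems by (intro Suc.IH) simp
  qed
  finally show ?case .
qed

text \<open>In the binomial expansion every power of the signed sum has exponent at most
  \<open>m\<close>, so each term satisfies the degree bound.\<close>

lemma signed_sum_alternant_shifted_power_eq_0:
  fixes a :: "nat \<Rightarrow> 'a::comm_ring_1"
  assumes "(\<Sum>i=0..<n. e i) + m < n ^ 2"
  shows "(\<Sum>I\<in>Pow {0..<n}. (\<Prod>i=0..<n. sign_flip I (\<lambda>_. 1) i) *
            alternant n (sign_flip I a) e * ((\<Sum>i=0..<n. sign_flip I a i) + c) ^ m) = 0"
proof -
  let ?w = "\<lambda>I. (\<Prod>i=0..<n. sign_flip I (\<lambda>_. 1) i) * alternant n (sign_flip I a) e"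
  let ?s = "\<lambda>I. \<Sum>i=0..<n. sign_flip I a i"
  have "(\<Sum>I\<in>Pow {0..<n}. ?w I * (?s I + c) ^ m)
      = (\<Sum>I\<in>Pow {0..<n}. \<Sum>k\<le>m. (of_nat (m choose k) * c ^ (m - k)) * (?w I * ?s I ^ k))"
    by (simp only: binomial_ring sum_distrib_left) (simp only: mult_ac)
  also have "\<dots> = (\<Sum>k\<le>m. (of_nat (m choose k) * c ^ (m - k)) * (\<Sum>I\<in>Pow {0..<n}. ?w I * ?s I ^ k))"
    by (subst sum.swap) (simp only: sum_distrib_left)
  also have "\<dots> = 0"
  proof (intro sum.neutral ballI)
    fix k assume "k \<in> {..m}"
    then have "(\<Sum>I\<in>Pow {0..<n}. ?w I * ?s I ^ k) = 0"
      using assms by (intro signed_sum_alternant_power_eq_0) simp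
    then show "(of_nat (m choose k) * c ^ (m - k)) * (\<Sum>I\<in>Pow {0..<n}. ?w I * ?s I ^ k) = 0"
      by (simp only: mult_zero_right)
  qed
  finally show ?thesis .
qed

section \<open>The Vandermonde determinant and the argument modulo p\<close>

text \<open>The product runs over ordered pairs, so up to sign it is the square of the Vandermonde
  determinant. Divisibility suffices: a prime dividing the determinant must divide some
  difference.\<close>

lemma Vandermonde_dvd:
  fixes y :: "nat \<Rightarrow> 'a::idom"
  shows "alternant n y (\<lambda>i. i) dvd (\<Prod>k=0..<n. \<Prod>j\<in>{0..<n}-{k}. y k - y j)"
proof -
  define P where "P k = (\<Prod>j\<in>{0..<n}-{k}. [:- y j, 1:])" for k
  have poly_P: "poly (P k) x = (\<Prod>j\<in>{0..<n}-{k}. x - y j)" for k x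
    by (simp add: P_def poly_prod)
  have degree_P: "degree (P k) < n" if "k < n" for k
  proof -
    have "degree (P k) \<le> (\<Sum>j\<in>{0..<n}-{k}. degree [:- y j, 1:])"
      unfolding P_def by (rule degree_prod_sum_le[unfolded o_def]) simp
    also have "\<dots> = n - 1" using that by simp
    finally show ?thesis using that by simp
  qed
  define M where "M = mat n n (\<lambda>(i, j). y j ^ i)"
  \<comment> \<open>Rows hold the coefficients of the Lagrange polynomials, so \<open>B * M\<close> is diagonal.\<close>
  define B where "B = mat n n (\<lambda>(k, i). coeff (P k) i)"
  have carrier: "M \<in> carrier_mat n n" "B \<in> carrier_mat n n"
    by (simp_all add: M_def B_def)
  have entry: "(B * M) $$ (k, j) = poly (P k) (y j)" if "k < n" "j < n" for k j
  proof -
    have "(B * M) $$ (k, j) = (\<Sum>i=0..<n. coeff (P k) i * y j ^ i)"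
      using that by (simp add: B_def M_def scalar_prod_def)
    also have "\<dots> = (\<Sum>i\<le>degree (P k). coeff (P k) i * y j ^ i)"
      using degree_P[OF that(1)]
      by (intro sum.mono_neutral_right) (auto simp: coeff_eq_0)
    finally show ?thesis by (simp add: poly_altdef)
  qed
  have "upper_triangular (B * M)"
    unfolding upper_triangular_def
    using carrier by (auto simp: entry poly_P simp del: index_mult_mat(1))
  then have "det (B * M) = prod_list (diag_mat (B * M))"
    by (rule det_upper_triangular) (use carrier in auto)
  also have "\<dots> = (\<Prod>k=0..<n. \<Prod>j\<in>{0..<n}-{k}. y k - y j)"
    using carrier
    by (auto simp: prod_list_diag_prod entry poly_P simp del: index_mult_mat(1) intro!: prod.cong)
  finally have "(\<Prod>k=0..<n. \<Prod>j\<in>{0..<n}-{k}. y k - y j) = det B * det M"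
    using det_mult[OF carrier(2,1)] by simp
  then show ?thesis by (simp add: alternant_def M_def)
qed

lemma fermat_theorem_int:
  fixes a :: int
  assumes "prime p" "\<not> int p dvd a"
  shows "int p dvd a ^ (p - 1) - 1"
proof -
  define b where "b = nat (a mod int p)"
  have b: "int b = a mod int p"
    using assms(1) by (simp add: b_def prime_gt_0_nat)
  have "\<not> int p dvd int b"
    using assms(2) by (simp add: b dvd_mod_iff)
  then have "[b ^ (p - 1) = 1] (mod p)"
    using assms(1) by (intro fermat_theorem) auto
  then have "[int b ^ (p - 1) = 1] (mod int p)"
    by (metis cong_int_iff of_nat_1 of_nat_power)
  then have "[a ^ (p - 1) = 1] (mod int p)"
    unfolding b cong_def by (simp add: power_mod)
  then show ?thesis by (simp add: cong_iff_dvd_diff)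
qed

lemma many_residues_have_zero_sum:
  fixes a :: "nat \<Rightarrow> int"
  assumes p: "prime p" "odd p" "p \<le> n * (n + 1) div 2"
    and distinct: "\<And>i j. i < n \<Longrightarrow> j < n \<Longrightarrow> i \<noteq> j \<Longrightarrow> \<not> int p dvd a i - a j"
  shows "\<exists>I\<subseteq>{0..<n}. I \<noteq> {} \<and> int p dvd (\<Sum>i\<in>I. a i)"
proof (rule ccontr)
  assume zsf: "\<not> ?thesis"
  have "prime (int p)" using p by simp
  let ?w = "\<lambda>I. (\<Prod>i=0..<n. sign_flip I (\<lambda>_. 1) i) * alternant n (sign_flip I a) (\<lambda>i. i)"
  let ?s = "\<lambda>I. (\<Sum>i=0..<n. sign_flip I a i) + (\<Sum>i=0..<n. a i)"
  \<comment> \<open>The exponents \<open>0, ..., n - 1\<close> leave room for any power below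
    \<open>n ^ 2 - n * (n - 1) / 2 = n * (n + 1) / 2\<close>, so the bound on \<open>p\<close> is
    exactly what the power \<open>p - 1\<close> needs.\<close>
  have sum_id: "2 * (\<Sum>i=0..<n. i) + n = n ^ 2"
    by (induction n) (auto simp: power2_eq_square)
  have "2 * (n * (n + 1) div 2) = n ^ 2 + n"
    by (simp add: power2_eq_square)
  with p(3) have "2 * p \<le> n ^ 2 + n" by linarith
  with sum_id prime_gt_0_nat[OF p(1)] have deg: "(\<Sum>i=0..<n. i) + (p - 1) < n ^ 2"
    by linarith
  have "(\<Sum>I\<in>Pow {0..<n}. ?w I * (?s I ^ (p - 1) - 1))
      = (\<Sum>I\<in>Pow {0..<n}. ?w I * ?s I ^ (p - 1)) - (\<Sum>I\<in>Pow {0..<n}. ?w I * ?s I ^ 0)"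
    by (simp only: right_diff_distrib sum_subtractf power_0)
  also have "\<dots> = 0"
    using signed_sum_alternant_shifted_power_eq_0[of "\<lambda>i. i" n "p - 1" a "\<Sum>i=0..<n. a i"]
      signed_sum_alternant_shifted_power_eq_0[of "\<lambda>i. i" n 0 a "\<Sum>i=0..<n. a i"] deg
    by simp
  finally have total: "(\<Sum>I\<in>Pow {0..<n}. ?w I * (?s I ^ (p - 1) - 1)) = 0" .
  have s: "?s I = 2 * (\<Sum>i\<in>I. a i)" if "I \<subseteq> {0..<n}" for I
  proof -
    have "?s I = (\<Sum>i=0..<n. if i \<in> I then 2 * a i else 0)"
      by (simp add: sign_flip_def flip: sum.distrib) (intro sum.cong, auto)
    also have "\<dots> = (\<Sum>i\<in>{0..<n} \<inter> I. 2 * a i)"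
      by (simp add: sum.inter_restrict)
    finally show ?thesis
      using that by (simp add: Int_absorb1 sum_distrib_left)
  qed
  \<comment> \<open>Oddness of \<open>p\<close> enters here: a multiple of \<open>p\<close> among
    the doubled subset sums would give a zero subset sum.\<close>
  have "\<not> int p dvd 2"
    using p(2) \<open>prime p\<close>
    by (metis int_dvd_int_iff of_nat_numeral primes_dvd_imp_eq two_is_prime_nat dvd_refl)
  then have "int p dvd ?s I ^ (p - 1) - 1" if "I \<in> Pow {0..<n} - {{}}" for I
    using that zsf \<open>prime (int p)\<close> p(1)
    by (intro fermat_theorem_int) (auto simp: s prime_dvd_mult_iff)
  then have rest: "int p dvd (\<Sum>I\<in>Pow {0..<n} - {{}}. ?w I * (?s I ^ (p - 1) - 1))"
    by (intro dvd_sum dvd_mult)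
  have "(\<Sum>I\<in>Pow {0..<n}. ?w I * (?s I ^ (p - 1) - 1)) = ?w {} * (?s {} ^ (p - 1) - 1)
      + (\<Sum>I\<in>Pow {0..<n} - {{}}. ?w I * (?s I ^ (p - 1) - 1))"
    by (rule sum.remove) auto
  then have "int p dvd ?w {} * (?s {} ^ (p - 1) - 1)
      + (\<Sum>I\<in>Pow {0..<n} - {{}}. ?w I * (?s I ^ (p - 1) - 1))"
    using total by (metis dvd_0_right)
  then have "int p dvd ?w {} * (?s {} ^ (p - 1) - 1)"
    by (simp only: dvd_add_left_iff[OF rest])
  \<comment> \<open>For the empty set the shifted sum is 0, and the exponent \<open>p - 1\<close> is
    positive.\<close>
  moreover have "?s {} ^ (p - 1) - 1 = -1"
    using s[of "{}"] prime_gt_1_nat[OF p(1)] by simp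
  moreover have "(\<Prod>i=0..<n. sign_flip {} (\<lambda>_. 1 :: int) i) = (-1) ^ n"
    by (simp add: sign_flip_def)
  ultimately have "int p dvd (-1) ^ n * alternant n (sign_flip {} a) (\<lambda>i. i)"
    by (simp only: mult_minus_right mult_1_right dvd_minus_iff)
  then have "int p dvd alternant n (sign_flip {} a) (\<lambda>i. i)"
    by (cases "even n") simp_all
  then have "int p dvd (\<Prod>k=0..<n. \<Prod>j\<in>{0..<n}-{k}. sign_flip {} a k - sign_flip {} a j)"
    using Vandermonde_dvd dvd_trans by blast
  then obtain k j where "k \<in> {0..<n}" "j \<in> {0..<n} - {k}"
      "int p dvd sign_flip {} a k - sign_flip {} a j"
    using \<open>prime (int p)\<close>
    by (simp only: prime_dvd_prod_iff finite_atLeastLessThan finite_Diff) blast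
  \<comment> \<open>Since \<open>sign_flip {} a\<close> is \<open>-a\<close>, the difference equals
    \<open>a j - a k\<close>, hence the swapped indices.\<close>
  then show False
    using distinct[of j k] by (simp add: sign_flip_def)
qed

section \<open>Translation between the residue ring and integers modulo p\<close>

lemma finsum_residue_ring:
  assumes "m > 1" "I \<subseteq> {0..m - 1}"
  shows "finsum (residue_ring m) (\<lambda>x. x) I = \<Sum>I mod m"
proof -
  interpret residues m "residue_ring m"
    using assms(1) by unfold_locales simp_all
  have "finite I" using assms(2) finite_subset by blast
  \<comment> \<open>Elements of the carrier are their own residues; inserting \<open>mod m\<close>
    gives the summand the form that \<open>sum_cong\<close> handles.\<close>
  have "finsum (residue_ring m) (\<lambda>x. x) I = finsum (residue_ring m) (\<lambda>x. x mod m) I"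
    by (rule finsum_cong') (use assms(2) in \<open>auto simp: res_carrier_eq\<close>)
  then show ?thesis using sum_cong[OF \<open>finite I\<close>, of "\<lambda>x. x"] by simp
qed

lemma zero_sum_free_residue_ring_iff:
  assumes "m > 1"
  shows "zero_sum_free (residue_ring m) A \<longleftrightarrow>
    A \<subseteq> {0..m - 1} \<and> (\<forall>I\<subseteq>A. I \<noteq> {} \<longrightarrow> \<not> m dvd \<Sum>I)"
proof -
  interpret residues m "residue_ring m"
    using assms by unfold_locales simp_all
  have "\<zero>\<^bsub>residue_ring m\<^esub> \<in> nonempty_subset_sums (residue_ring m) A \<longleftrightarrow>
      (\<exists>I\<subseteq>A. I \<noteq> {} \<and> m dvd \<Sum>I)" if "A \<subseteq> {0..m - 1}"
  proof -
    have "0 = finsum (residue_ring m) (\<lambda>x. x) I \<longleftrightarrow> m dvd \<Sum>I" if "I \<subseteq> A" for I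
      using that \<open>A \<subseteq> _\<close> assms by (subst finsum_residue_ring) auto
    then show ?thesis
      unfolding nonempty_subset_sums_def res_zero_eq mem_Collect_eq by blast
  qed
  then show ?thesis
    unfolding zero_sum_free_def res_carrier_eq by blast
qed

lemma zero_sum_free_card_bound:
  assumes p: "prime p" and zsf: "zero_sum_free (residue_ring (int p)) A"
  shows "card A * (card A + 1) div 2 < p"
proof -
  have A: "A \<subseteq> {0..int p - 1}" and sums: "\<And>I. I \<subseteq> A \<Longrightarrow> I \<noteq> {} \<Longrightarrow> \<not> int p dvd \<Sum>I"
    using zsf prime_gt_1_nat[OF p] by (auto simp: zero_sum_free_residue_ring_iff)
  have "finite A" using A finite_subset by blast
  show ?thesis
  \<comment> \<open>The prime 2 is treated by hand, because
    \<open>many_residues_have_zero_sum\<close> cancels a factor 2 modulo \<open>p\<close>.\<close>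
  proof (cases "p = 2")
    case True
    have "0 \<notin> A" using sums[of "{0}"] by auto
    have "x = 1" if "x \<in> A" for x
    proof -
      have "0 \<le> x" "x \<le> 1" using A True that by auto
      moreover have "x \<noteq> 0" using \<open>0 \<notin> A\<close> that by blast
      ultimately show ?thesis by simp
    qed
    then have "A \<subseteq> {1}" by blast
    then have "card A \<le> 1" using card_mono[of "{1}" A] by simp
    then have "card A = 0 \<or> card A = 1" by linarith
    then show ?thesis using True by auto
  next
    case False
    then have "odd p" using p primes_dvd_imp_eq two_is_prime_nat by blast
    obtain a where a: "bij_betw a {0..<card A} A"
      using ex_bij_betw_nat_finite[OF \<open>finite A\<close>] by blast
    show ?thesis
    proof (rule ccontr)
      assume "\<not> ?thesis"
      then have le: "p \<le> card A * (card A + 1) div 2" by simp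
      have "\<not> int p dvd a i - a j" if "i < card A" "j < card A" "i \<noteq> j" for i j
      proof
        assume dvd: "int p dvd a i - a j"
        have "a i \<in> A" "a j \<in> A" using a that by (auto simp: bij_betw_def)
        then have "0 \<le> a i" "a i < int p" "0 \<le> a j" "a j < int p" using A by force+
        then have "\<bar>a i - a j\<bar> < int p" by linarith
        with dvd have "a i = a j" using dvd_imp_le_int[of "a i - a j" "int p"] by fastforce
        then show False using a that by (auto simp: bij_betw_def inj_on_def)
      qed
      then obtain I where I: "I \<subseteq> {0..<card A}" "I \<noteq> {}" "int p dvd (\<Sum>i\<in>I. a i)"
        using many_residues_have_zero_sum[OF p \<open>odd p\<close> le, of a] by blast
      have "inj_on a I" using a I(1) by (auto simp: bij_betw_def intro: inj_on_subset)
      then have "\<Sum>(a ` I) = (\<Sum>i\<in>I. a i)" by (simp add: sum.reindex)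
      moreover have "a ` I \<subseteq> A" using a I(1) by (auto simp: bij_betw_def)
      ultimately show False using sums[of "a ` I"] I by auto
    qed
  qed
qed

section \<open>The extremal example and the conclusion\<close>

text \<open>Every nonempty subset sum is positive and at most the full sum
  \<open>k * (k + 1) div 2\<close>, so it lies strictly between 0 and \<open>p\<close>.\<close>

lemma zero_sum_free_initial_interval:
  assumes p: "p > 1" and k: "k * (k + 1) div 2 < p"
  shows "zero_sum_free (residue_ring (int p)) {1..int k}"
proof -
  have total: "\<Sum>{1..int k} = int (k * (k + 1) div 2)"
  proof -
    have "{1..int k} = int ` {1..k}"
      by (auto simp: image_int_atLeastAtMost)
    then have "\<Sum>{1..int k} = int (\<Sum>{1..k})"
      by (simp add: sum.reindex)
    also have "\<Sum>{1..k} = k * (k + 1) div 2"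
      using Sum_Icc_nat[of 1 k] by simp
    finally show ?thesis .
  qed
  have "\<not> int p dvd \<Sum>I" if "I \<subseteq> {1..int k}" "I \<noteq> {}" for I
  proof -
    have "finite I" using that(1) finite_subset by blast
    have "\<Sum>I > 0" using that \<open>finite I\<close> by (intro sum_pos) auto
    moreover have "\<Sum>I \<le> \<Sum>{1..int k}" using that by (intro sum_mono2) auto
    then have "\<Sum>I < int p" using k total by linarith
    ultimately show ?thesis using zdvd_not_zless by blast
  qed
  moreover have "{1..int k} \<subseteq> {0..int p - 1}"
  proof -
    have "2 * k \<le> k * (k + 1)" if "k > 0" using that by (cases k) auto
    then have "k \<le> k * (k + 1) div 2" by (cases "k = 0") linarith+
    with k have "k < p" by linarith
    then show ?thesis by auto
  qed
  ultimately show ?thesis using p by (auto simp: zero_sum_free_residue_ring_iff)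
qed

theorem theorem9:
  fixes p :: nat and A :: "int set"
  assumes "prime p"
    and "zero_sum_free (residue_ring (int p)) A"
    and "\<And>B. zero_sum_free (residue_ring (int p)) B \<Longrightarrow> card B \<le> card A"
  shows "int (card A) = (GREATEST k::int. real_of_int (k * (k + 1)) / 2 < real p)"
proof -
  \<comment> \<open>As \<open>k * (k + 1)\<close> is even, the natural-number division is exact and
    agrees with the real quotient.\<close>
  have iff: "real_of_int (int k * (int k + 1)) / 2 < real p \<longleftrightarrow> k * (k + 1) div 2 < p" for k
  proof -
    have "2 * (k * (k + 1) div 2) = k * (k + 1)" by simp
    then have "k * (k + 1) div 2 < p \<longleftrightarrow> k * (k + 1) < 2 * p" by linarith
    also have "\<dots> \<longleftrightarrow> real (k * (k + 1)) < real (2 * p)" by (simp only: of_nat_less_iff)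
    finally show ?thesis by (simp add: field_simps)
  qed
  have "(GREATEST k::int. real_of_int (k * (k + 1)) / 2 < real p) = int (card A)"
  proof (rule Greatest_equality)
    show "real_of_int (int (card A) * (int (card A) + 1)) / 2 < real p"
      using zero_sum_free_card_bound[OF assms(1,2)] iff by blast
  next
    fix k :: int
    assume k: "real_of_int (k * (k + 1)) / 2 < real p"
    show "k \<le> int (card A)"
    \<comment> \<open>\<open>GREATEST\<close> ranges over all integers. Negative candidates lie
      below any cardinality; for the others maximality of \<open>A\<close> is applied to the
      interval from 1 to \<open>k\<close>.\<close>
    proof (cases "k \<ge> 0")
      case True
      then obtain m where m: "k = int m" using nonneg_int_cases by blast
      then have "zero_sum_free (residue_ring (int p)) {1..int m}"
        using k iff prime_gt_1_nat[OF assms(1)] by (intro zero_sum_free_initial_interval) auto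
      from assms(3)[OF this] show ?thesis using m by simp
    qed simp
  qed
  then show ?thesis by simp
qed

end
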